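(* Let $G$ be a trunc. A convex subtrunc $K\subseteq G$ is a truncation kernel if and only if it satisfies properties (2) and (3) below; it is an archimedean truncation kernel if and only if it also satisfies (1). Here $g$ ranges over $G^+$ and $n$ over the positive integers. (1) If there exists $h\in G^+$ such that $(ng-h)^+\in K$ for all $n$, then $g\in K$. (2) If $\overline g\in K$ then $g\in K$. (3) If $g\ominus 1/n\in K$ for all $n$, then $g\in K$.
   Context: All vector lattices are real. A truncation on an archimedean vector lattice $G$ is a unary operation $g\mapsto\overline g$ on the positive cone $G^+$ such that for all $g,h\in G^+$: $g\wedge\overline h\le\overline g\le g$; if $\overline g=0$ then $g=0$; if $ng=\overline{ng}$ for all positive integers $n$ then $g=0$. A trunc is an archimedean vector lattice equipped with a truncation. A truncation homomorphism is a vector lattice homomorphism $\theta\colon G\to H$ between truncs such that $\theta(\overline g)=\overline{\theta(g)}$ for all $g\in G^+$; $\mathbf T$ is the category of truncs and truncation homomorphisms. For $g\in G^+$ and real $r>0$, $g\ominus1=g-\overline g$ and $g\ominus r=r\big((g/r)\ominus1\big)$. A convex subtrunc of $G$ is an order-convex vector sublattice closed under truncation. A truncation kernel is the set of elements of a trunc sent to $0$ by a morphism of $\mathbf T$. An archimedean truncation kernel is a truncation kernel $K$ for which the quotient $G/K$ is archimedean.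
   Formalization: The codomain of the morphism defining a truncation kernel is a vector lattice with a truncation, not required to be archimedean; with archimedean codomains the first equivalence fails (G = R^N with g∧1, K = c_0). *)

theory Defs
  imports Complex_Main "HOL-Algebra.AbelCoset" "HOL-Algebra.Module" "HOL-Algebra.Lattice"
begin

text \<open>
  A real vector lattice is a module over the field of real numbers together with a compatible
  lattice order. The fields \<open>mult\<close> and \<open>one\<close>, which \<open>module\<close> inherits from \<open>ring\<close>, play no role.
\<close>

record 'a vlattice = "(real, 'a) module" +
  vle :: "['a, 'a] \<Rightarrow> bool" (infixl \<open>\<preceq>\<index>\<close> 50)

definition real_ring :: "real ring" where
  "real_ring = \<lparr>carrier = UNIV, mult = (*), one = 1, zero = 0, add = (+)\<rparr>"

definition vl_order :: "('a, 'm) vlattice_scheme \<Rightarrow> 'a gorder" where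
  "vl_order V = \<lparr>carrier = carrier V, eq = (=), le = vle V\<rparr>"

abbreviation vjoin :: "[('a, 'm) vlattice_scheme, 'a, 'a] \<Rightarrow> 'a" where
  "vjoin V \<equiv> join (vl_order V)"

abbreviation vmeet :: "[('a, 'm) vlattice_scheme, 'a, 'a] \<Rightarrow> 'a" where
  "vmeet V \<equiv> meet (vl_order V)"

locale vector_lattice = module real_ring V + L: lattice "vl_order V"
    for V :: "('a, 'm) vlattice_scheme" (structure) +
  assumes vle_add: "\<lbrakk>x \<in> carrier V; y \<in> carrier V; z \<in> carrier V; x \<preceq> y\<rbrakk> \<Longrightarrow> x \<oplus> z \<preceq> y \<oplus> z"
    and vle_smult: "\<lbrakk>0 \<le> r; x \<in> carrier V; y \<in> carrier V; x \<preceq> y\<rbrakk> \<Longrightarrow> r \<odot> x \<preceq> r \<odot> y"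

definition pos_cone :: "('a, 'm) vlattice_scheme \<Rightarrow> 'a set" where
  "pos_cone V = {x \<in> carrier V. \<zero>\<^bsub>V\<^esub> \<preceq>\<^bsub>V\<^esub> x}"

definition pos_part :: "('a, 'm) vlattice_scheme \<Rightarrow> 'a \<Rightarrow> 'a" where
  "pos_part V x = vjoin V x \<zero>\<^bsub>V\<^esub>"

definition archimedean :: "('a, 'm) vlattice_scheme \<Rightarrow> bool" where
  "archimedean V \<longleftrightarrow>
     (\<forall>g \<in> pos_cone V. \<forall>h \<in> pos_cone V.
        (\<forall>n::nat. 0 < n \<longrightarrow> real n \<odot>\<^bsub>V\<^esub> g \<preceq>\<^bsub>V\<^esub> h) \<longrightarrow> g = \<zero>\<^bsub>V\<^esub>)"

text \<open>The values of \<open>trunc_op\<close> outside the positive cone are irrelevant.\<close>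

record 'a truncated = "'a vlattice" +
  trunc_op :: "'a \<Rightarrow> 'a"

locale truncated_vector_lattice = vector_lattice G for G :: "'a truncated" (structure) +
  assumes trunc_closed: "g \<in> pos_cone G \<Longrightarrow> trunc_op G g \<in> pos_cone G"
    and meet_trunc_le:
      "\<lbrakk>g \<in> pos_cone G; h \<in> pos_cone G\<rbrakk> \<Longrightarrow> vmeet G g (trunc_op G h) \<preceq> trunc_op G g"
    and trunc_le: "g \<in> pos_cone G \<Longrightarrow> trunc_op G g \<preceq> g"
    and trunc_eq_zero: "\<lbrakk>g \<in> pos_cone G; trunc_op G g = \<zero>\<rbrakk> \<Longrightarrow> g = \<zero>"
    and trunc_multiples:
      "\<lbrakk>g \<in> pos_cone G; \<And>n::nat. 0 < n \<Longrightarrow> real n \<odot> g = trunc_op G (real n \<odot> g)\<rbrakk> \<Longrightarrow> g = \<zero>"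

locale trunc = truncated_vector_lattice +
  assumes archimedean: "archimedean G"

definition vector_lattice_hom ::
    "('a, 'm) vlattice_scheme \<Rightarrow> ('b, 'n) vlattice_scheme \<Rightarrow> ('a \<Rightarrow> 'b) set" where
  "vector_lattice_hom V W =
     {\<theta>. \<theta> \<in> carrier V \<rightarrow> carrier W \<and>
        (\<forall>x \<in> carrier V. \<forall>y \<in> carrier V. \<theta> (x \<oplus>\<^bsub>V\<^esub> y) = \<theta> x \<oplus>\<^bsub>W\<^esub> \<theta> y) \<and>
        (\<forall>r. \<forall>x \<in> carrier V. \<theta> (r \<odot>\<^bsub>V\<^esub> x) = r \<odot>\<^bsub>W\<^esub> \<theta> x) \<and>
        (\<forall>x \<in> carrier V. \<forall>y \<in> carrier V. \<theta> (vjoin V x y) = vjoin W (\<theta> x) (\<theta> y)) \<and>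
        (\<forall>x \<in> carrier V. \<forall>y \<in> carrier V. \<theta> (vmeet V x y) = vmeet W (\<theta> x) (\<theta> y))}"

definition truncation_hom :: "'a truncated \<Rightarrow> 'b truncated \<Rightarrow> ('a \<Rightarrow> 'b) set" where
  "truncation_hom G H =
     {\<theta> \<in> vector_lattice_hom G H. \<forall>g \<in> pos_cone G. \<theta> (trunc_op G g) = trunc_op H (\<theta> g)}"

definition ominus_one :: "'a truncated \<Rightarrow> 'a \<Rightarrow> 'a" where
  "ominus_one G g = g \<ominus>\<^bsub>G\<^esub> trunc_op G g"

definition ominus :: "'a truncated \<Rightarrow> 'a \<Rightarrow> real \<Rightarrow> 'a" where
  "ominus G g r = r \<odot>\<^bsub>G\<^esub> ominus_one G ((1 / r) \<odot>\<^bsub>G\<^esub> g)"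

definition convex_subtrunc :: "'a truncated \<Rightarrow> 'a set \<Rightarrow> bool" where
  "convex_subtrunc G K \<longleftrightarrow>
     submodule K real_ring G \<and>
     (\<forall>x \<in> K. \<forall>y \<in> K. vjoin G x y \<in> K \<and> vmeet G x y \<in> K) \<and>
     (\<forall>x \<in> K. \<forall>y \<in> K. \<forall>z \<in> carrier G. x \<preceq>\<^bsub>G\<^esub> z \<and> z \<preceq>\<^bsub>G\<^esub> y \<longrightarrow> z \<in> K) \<and>
     (\<forall>g \<in> K \<inter> pos_cone G. trunc_op G g \<in> K)"

definition vl_quotient :: "('a, 'm) vlattice_scheme \<Rightarrow> 'a set \<Rightarrow> 'a set vlattice" where
  "vl_quotient V K =
     \<lparr>carrier = a_rcosets\<^bsub>V\<^esub> K, mult = undefined, one = undefined,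
      zero = K, add = set_add V,
      smult = (\<lambda>r A. \<Union>x\<in>A. K +>\<^bsub>V\<^esub> (r \<odot>\<^bsub>V\<^esub> x)),
      vle = (\<lambda>A B. \<exists>x\<in>A. \<exists>y\<in>B. x \<preceq>\<^bsub>V\<^esub> y)\<rparr>"

text \<open>
  The codomain of the homomorphism satisfies the three truncation axioms but need not be
  archimedean. Were it archimedean, so would be the quotient by the kernel, which embeds in it;
  ``archimedean truncation kernel'' would then say no more than ``truncation kernel''.

  The codomain has carrier in \<open>'a set\<close>, where the cosets of \<open>K\<close> live. Lemma
  \<open>truncation_kernelI\<close> below shows that no kernel is lost: kernels of homomorphisms into
  codomains over an arbitrary type are included.
\<close>

definition truncation_kernel :: "'a truncated \<Rightarrow> 'a set \<Rightarrow> bool" where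
  "truncation_kernel G K \<longleftrightarrow>
     (\<exists>(H :: 'a set truncated) \<theta>.
        truncated_vector_lattice H \<and> \<theta> \<in> truncation_hom G H \<and> K = a_kernel G H \<theta>)"

definition archimedean_truncation_kernel :: "'a truncated \<Rightarrow> 'a set \<Rightarrow> bool" where
  "archimedean_truncation_kernel G K \<longleftrightarrow> truncation_kernel G K \<and> archimedean (vl_quotient G K)"

definition kernel_property_1 :: "'a truncated \<Rightarrow> 'a set \<Rightarrow> bool" where
  "kernel_property_1 G K \<longleftrightarrow>
     (\<forall>g \<in> pos_cone G.
        (\<exists>h \<in> pos_cone G. \<forall>n::nat. 0 < n \<longrightarrow> pos_part G (real n \<odot>\<^bsub>G\<^esub> g \<ominus>\<^bsub>G\<^esub> h) \<in> K) \<longrightarrow> g \<in> K)"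

definition kernel_property_2 :: "'a truncated \<Rightarrow> 'a set \<Rightarrow> bool" where
  "kernel_property_2 G K \<longleftrightarrow> (\<forall>g \<in> pos_cone G. trunc_op G g \<in> K \<longrightarrow> g \<in> K)"

definition kernel_property_3 :: "'a truncated \<Rightarrow> 'a set \<Rightarrow> bool" where
  "kernel_property_3 G K \<longleftrightarrow>
     (\<forall>g \<in> pos_cone G. (\<forall>n::nat. 0 < n \<longrightarrow> ominus G g (1 / real n) \<in> K) \<longrightarrow> g \<in> K)"

lemma real_ring_simps [simp]:
  "carrier real_ring = UNIV" "add real_ring = (+)" "mult real_ring = (*)"
  "zero real_ring = 0" "one real_ring = 1"
  by (simp_all add: real_ring_def)

lemma real_ring_cring: "cring real_ring"
  by (unfold real_ring_def)
    (auto intro!: cringI abelian_groupI comm_monoidI left_minus distrib_right)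

lemma vl_order_simps [simp]:
  "carrier (vl_order V) = carrier V" "eq (vl_order V) = (=)" "le (vl_order V) = vle V"
  by (simp_all add: vl_order_def)

lemma vector_lattice_intro:
  fixes V :: "('a, 'm) vlattice_scheme"
  assumes mod: "module real_ring V"
    and refl: "\<And>x. x \<in> carrier V \<Longrightarrow> vle V x x"
    and antisym: "\<And>x y. \<lbrakk>x \<in> carrier V; y \<in> carrier V; vle V x y; vle V y x\<rbrakk> \<Longrightarrow> x = y"
    and trans: "\<And>x y z. \<lbrakk>x \<in> carrier V; y \<in> carrier V; z \<in> carrier V; vle V x y; vle V y z\<rbrakk>
                  \<Longrightarrow> vle V x z"
    and j: "\<And>x y. \<lbrakk>x \<in> carrier V; y \<in> carrier V\<rbrakk> \<Longrightarrow> j x y \<in> carrier V \<and> vle V x (j x y) \<and>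
              vle V y (j x y) \<and> (\<forall>z \<in> carrier V. vle V x z \<and> vle V y z \<longrightarrow> vle V (j x y) z)"
    and m: "\<And>x y. \<lbrakk>x \<in> carrier V; y \<in> carrier V\<rbrakk> \<Longrightarrow> m x y \<in> carrier V \<and> vle V (m x y) x \<and>
              vle V (m x y) y \<and> (\<forall>z \<in> carrier V. vle V z x \<and> vle V z y \<longrightarrow> vle V z (m x y))"
    and add: "\<And>x y z. \<lbrakk>x \<in> carrier V; y \<in> carrier V; z \<in> carrier V; vle V x y\<rbrakk>
                \<Longrightarrow> vle V (x \<oplus>\<^bsub>V\<^esub> z) (y \<oplus>\<^bsub>V\<^esub> z)"
    and smult: "\<And>r x y. \<lbrakk>0 \<le> r; x \<in> carrier V; y \<in> carrier V; vle V x y\<rbrakk>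
                  \<Longrightarrow> vle V (r \<odot>\<^bsub>V\<^esub> x) (r \<odot>\<^bsub>V\<^esub> y)"
  shows "vector_lattice V"
    and "\<And>x y. \<lbrakk>x \<in> carrier V; y \<in> carrier V\<rbrakk> \<Longrightarrow> vjoin V x y = j x y"
    and "\<And>x y. \<lbrakk>x \<in> carrier V; y \<in> carrier V\<rbrakk> \<Longrightarrow> vmeet V x y = m x y"
proof -
  have lub: "least (vl_order V) (j x y) (Upper (vl_order V) {x, y})"
    if "x \<in> carrier V" "y \<in> carrier V" for x y
    using j[OF that] that by (auto simp: least_def Upper_def)
  have glb: "greatest (vl_order V) (m x y) (Lower (vl_order V) {x, y})"
    if "x \<in> carrier V" "y \<in> carrier V" for x y
    using m[OF that] that by (auto simp: greatest_def Lower_def)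
  have po: "partial_order (vl_order V)"
    by unfold_locales (auto intro: refl antisym trans)
  have lat: "lattice (vl_order V)"
    unfolding lattice_def upper_semilattice_def lower_semilattice_def
      upper_semilattice_axioms_def lower_semilattice_axioms_def
    by (intro conjI allI impI po exI) (auto intro: lub glb)
  then interpret L: lattice "vl_order V" .
  show "vector_lattice V"
    by (simp add: vector_lattice_def vector_lattice_axioms_def mod lat add smult)
  show "vjoin V x y = j x y" if "x \<in> carrier V" "y \<in> carrier V" for x y
    unfolding join_def sup_def by (rule some_equality) (use lub[OF that] L.least_unique in auto)
  show "vmeet V x y = m x y" if "x \<in> carrier V" "y \<in> carrier V" for x y
    unfolding meet_def inf_def by (rule some_equality) (use glb[OF that] L.greatest_unique in auto)
qed

text \<open>
  The image of a homomorphism is transported to the set of its fibres, that is, to the cosets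
  of its kernel.
\<close>

lemma truncation_kernelI:
  fixes G :: "'a truncated" and H :: "'b truncated"
  assumes G: "truncated_vector_lattice G" and H: "truncated_vector_lattice H"
    and hom: "\<theta> \<in> truncation_hom G H"
  shows "truncation_kernel G (a_kernel G H \<theta>)"
proof -
  interpret G: truncated_vector_lattice G by (rule G)
  interpret H: truncated_vector_lattice H by (rule H)
  note [rule del] = G.L.le_antisym H.L.le_antisym G.L.weak_le_antisym H.L.weak_le_antisym
  have th: "\<And>x. x \<in> carrier G \<Longrightarrow> \<theta> x \<in> carrier H"
    and th_add: "\<And>x y. \<lbrakk>x \<in> carrier G; y \<in> carrier G\<rbrakk> \<Longrightarrow> \<theta> (x \<oplus>\<^bsub>G\<^esub> y) = \<theta> x \<oplus>\<^bsub>H\<^esub> \<theta> y"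
    and th_smult: "\<And>r x. x \<in> carrier G \<Longrightarrow> \<theta> (r \<odot>\<^bsub>G\<^esub> x) = r \<odot>\<^bsub>H\<^esub> \<theta> x"
    and th_join: "\<And>x y. \<lbrakk>x \<in> carrier G; y \<in> carrier G\<rbrakk> \<Longrightarrow> \<theta> (vjoin G x y) = vjoin H (\<theta> x) (\<theta> y)"
    and th_meet: "\<And>x y. \<lbrakk>x \<in> carrier G; y \<in> carrier G\<rbrakk> \<Longrightarrow> \<theta> (vmeet G x y) = vmeet H (\<theta> x) (\<theta> y)"
    and th_trunc: "\<And>x. x \<in> pos_cone G \<Longrightarrow> \<theta> (trunc_op G x) = trunc_op H (\<theta> x)"
    using hom by (auto simp: truncation_hom_def vector_lattice_hom_def)
  have th_zero: "\<theta> \<zero>\<^bsub>G\<^esub> = \<zero>\<^bsub>H\<^esub>"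
    using th_smult[of "\<zero>\<^bsub>G\<^esub>" 0] th[of "\<zero>\<^bsub>G\<^esub>"] G.smult_l_null[of "\<zero>\<^bsub>G\<^esub>"] H.smult_l_null[of "\<theta> \<zero>\<^bsub>G\<^esub>"]
    by simp
  have Gsm: "r \<odot>\<^bsub>G\<^esub> x \<in> carrier G" if "x \<in> carrier G" for r x
    using G.smult_closed[of r x] that by simp
  have Gj: "vjoin G x y \<in> carrier G" "vmeet G x y \<in> carrier G"
    if "x \<in> carrier G" "y \<in> carrier G" for x y
    using G.L.join_closed[of x y] G.L.meet_closed[of x y] that by simp_all
  have H_refl: "vle H a a" if "a \<in> carrier H" for a
    using H.L.le_refl[of a] that by simp
  define I where "I = \<theta> ` carrier G"
  define F where "F y = {x \<in> carrier G. \<theta> x = y}" for y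
  define E where "E A = \<theta> (SOME x. x \<in> A)" for A
  have EF [simp]: "E (F y) = y" if "y \<in> I" for y
  proof -
    have "\<exists>x. x \<in> F y" using that by (auto simp: I_def F_def)
    then have "(SOME x. x \<in> F y) \<in> F y" by (rule someI_ex)
    then show ?thesis by (simp add: E_def F_def)
  qed
  have Feq: "F a = F b \<longleftrightarrow> a = b" if "a \<in> I" "b \<in> I" for a b
    using EF that by metis
  have I_sub [simp]: "y \<in> carrier H" if "y \<in> I" for y
    using that th by (auto simp: I_def)
  have I_zero [simp]: "\<zero>\<^bsub>H\<^esub> \<in> I"
    using th_zero by (auto simp: I_def image_iff intro!: bexI[of _ "\<zero>\<^bsub>G\<^esub>"])
  have I_add [simp]: "a \<oplus>\<^bsub>H\<^esub> b \<in> I" if "a \<in> I" "b \<in> I" for a b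
    using that unfolding I_def by (auto simp: th_add[symmetric])
  have I_smult [simp]: "r \<odot>\<^bsub>H\<^esub> a \<in> I" if "a \<in> I" for a r
    using that unfolding I_def by (auto simp: th_smult[symmetric] Gsm)
  have I_join [simp]: "vjoin H a b \<in> I" if "a \<in> I" "b \<in> I" for a b
    using that unfolding I_def by (auto simp: th_join[symmetric] Gj)
  have I_meet [simp]: "vmeet H a b \<in> I" if "a \<in> I" "b \<in> I" for a b
    using that unfolding I_def by (auto simp: th_meet[symmetric] Gj)
  have I_trunc: "trunc_op H a \<in> I" if aI: "a \<in> I" "a \<in> pos_cone H" for a
  proof -
    obtain x where x: "x \<in> carrier G" "a = \<theta> x" using aI(1) unfolding I_def by blast
    have "\<zero>\<^bsub>G\<^esub> \<sqsubseteq>\<^bsub>vl_order G\<^esub> vjoin G x \<zero>\<^bsub>G\<^esub>" by (rule G.L.join_right) (simp_all add: x)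
    then have p: "vjoin G x \<zero>\<^bsub>G\<^esub> \<in> pos_cone G" using x Gj by (simp add: pos_cone_def)
    have "\<theta> (vjoin G x \<zero>\<^bsub>G\<^esub>) = vjoin H a \<zero>\<^bsub>H\<^esub>" using x th_zero by (simp add: th_join)
    also have "\<dots> = a"
    proof (rule H.L.le_antisym)
      show "vjoin H a \<zero>\<^bsub>H\<^esub> \<sqsubseteq>\<^bsub>vl_order H\<^esub> a"
        by (rule H.L.join_le) (use that H_refl in \<open>simp_all add: pos_cone_def\<close>)
      show "a \<sqsubseteq>\<^bsub>vl_order H\<^esub> vjoin H a \<zero>\<^bsub>H\<^esub>"
        by (rule H.L.join_left) (use that in simp_all)
    qed (use that in simp_all)
    finally have "trunc_op H a = \<theta> (trunc_op G (vjoin G x \<zero>\<^bsub>G\<^esub>))" using th_trunc[OF p] by simp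
    moreover have "trunc_op G (vjoin G x \<zero>\<^bsub>G\<^esub>) \<in> carrier G"
      using G.trunc_closed[OF p] by (simp add: pos_cone_def)
    ultimately show ?thesis by (simp add: I_def)
  qed
  define Q :: "'a set truncated" where
    "Q = \<lparr>carrier = F ` I, mult = undefined, one = undefined, zero = F \<zero>\<^bsub>H\<^esub>,
          add = (\<lambda>A B. F (E A \<oplus>\<^bsub>H\<^esub> E B)), smult = (\<lambda>r A. F (r \<odot>\<^bsub>H\<^esub> E A)),
          vle = (\<lambda>A B. vle H (E A) (E B)), trunc_op = (\<lambda>A. F (trunc_op H (E A)))\<rparr>"
  have Qs [simp]: "carrier Q = F ` I" "\<zero>\<^bsub>Q\<^esub> = F \<zero>\<^bsub>H\<^esub>"
    "\<And>A B. A \<oplus>\<^bsub>Q\<^esub> B = F (E A \<oplus>\<^bsub>H\<^esub> E B)" "\<And>r A. r \<odot>\<^bsub>Q\<^esub> A = F (r \<odot>\<^bsub>H\<^esub> E A)"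
    "\<And>A B. vle Q A B = vle H (E A) (E B)" "\<And>A. trunc_op Q A = F (trunc_op H (E A))"
    by (simp_all add: Q_def)
  have ab: "abelian_group Q"
  proof (rule abelian_groupI)
    fix A assume A: "A \<in> carrier Q"
    then obtain a where a: "a \<in> I" "A = F a" by auto
    have "(- 1) \<odot>\<^bsub>H\<^esub> a \<oplus>\<^bsub>H\<^esub> a = ((- 1) + 1) \<odot>\<^bsub>H\<^esub> a"
      using a H.smult_l_distr[of "- 1" 1 a] H.smult_one[of a] by simp
    also have "\<dots> = \<zero>\<^bsub>H\<^esub>" using a H.smult_l_null[of a] by simp
    finally show "\<exists>B \<in> carrier Q. B \<oplus>\<^bsub>Q\<^esub> A = \<zero>\<^bsub>Q\<^esub>"
      using a by (auto intro!: bexI[of _ "(- 1) \<odot>\<^bsub>H\<^esub> a"])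
  qed (auto simp: H.M.a_assoc H.M.a_comm H.M.a_lcomm)
  have mod: "module real_ring Q"
  proof (rule moduleI)
    show "cring real_ring" by (rule real_ring_cring)
    show "abelian_group Q" by (rule ab)
  qed (use H.smult_l_distr H.smult_r_distr H.smult_assoc1 H.smult_one in auto)
  note VL = vector_lattice_intro[of Q "\<lambda>A B. F (vjoin H (E A) (E B))" "\<lambda>A B. F (vmeet H (E A) (E B))", OF mod]
  have refl: "vle Q A A" if "A \<in> carrier Q" for A
    using that H.L.le_refl by auto
  have antisym: "A = B" if AB: "A \<in> carrier Q" "B \<in> carrier Q" "vle Q A B" "vle Q B A" for A B
  proof -
    obtain a b where "a \<in> I" "b \<in> I" "A = F a" "B = F b" using AB(1,2) by auto
    then show ?thesis using AB(3,4) H.L.le_antisym[of a b] by simp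
  qed
  have trans: "vle Q A C"
    if ABC: "A \<in> carrier Q" "B \<in> carrier Q" "C \<in> carrier Q" "vle Q A B" "vle Q B C" for A B C
  proof -
    obtain a b c where "a \<in> I" "b \<in> I" "c \<in> I" "A = F a" "B = F b" "C = F c"
      using ABC(1-3) by auto
    then show ?thesis using ABC(4,5) H.L.le_trans[of a b c] by simp
  qed
  have j: "F (vjoin H (E A) (E B)) \<in> carrier Q \<and> vle Q A (F (vjoin H (E A) (E B))) \<and>
      vle Q B (F (vjoin H (E A) (E B))) \<and>
      (\<forall>C \<in> carrier Q. vle Q A C \<and> vle Q B C \<longrightarrow> vle Q (F (vjoin H (E A) (E B))) C)"
    if "A \<in> carrier Q" "B \<in> carrier Q" for A B
    using that H.L.join_left H.L.join_right H.L.join_le by auto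
  have m: "F (vmeet H (E A) (E B)) \<in> carrier Q \<and> vle Q (F (vmeet H (E A) (E B))) A \<and>
      vle Q (F (vmeet H (E A) (E B))) B \<and>
      (\<forall>C \<in> carrier Q. vle Q C A \<and> vle Q C B \<longrightarrow> vle Q C (F (vmeet H (E A) (E B))))"
    if "A \<in> carrier Q" "B \<in> carrier Q" for A B
    using that H.L.meet_left H.L.meet_right H.L.meet_le by auto
  have add: "vle Q (A \<oplus>\<^bsub>Q\<^esub> C) (B \<oplus>\<^bsub>Q\<^esub> C)"
    if "A \<in> carrier Q" "B \<in> carrier Q" "C \<in> carrier Q" "vle Q A B" for A B C
    using that H.vle_add by auto
  have smult: "vle Q (r \<odot>\<^bsub>Q\<^esub> A) (r \<odot>\<^bsub>Q\<^esub> B)"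
    if "0 \<le> r" "A \<in> carrier Q" "B \<in> carrier Q" "vle Q A B" for r A B
    using that H.vle_smult by auto
  note VL = VL[OF refl antisym trans j m add smult]
  have vl: "vector_lattice Q" by (rule VL(1))
  have jn: "vjoin Q A B = F (vjoin H (E A) (E B))" if "A \<in> carrier Q" "B \<in> carrier Q" for A B
    by (rule VL(2)) (use that in simp_all)
  have mt: "vmeet Q A B = F (vmeet H (E A) (E B))" if "A \<in> carrier Q" "B \<in> carrier Q" for A B
    by (rule VL(3)) (use that in simp_all)
  have pos: "A \<in> pos_cone Q \<longleftrightarrow> (\<exists>a. a \<in> I \<and> a \<in> pos_cone H \<and> A = F a)" for A
    by (auto simp: pos_cone_def)
  have trunc_pos: "trunc_op H a \<in> I" "trunc_op H a \<in> pos_cone H"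
    if "a \<in> I" "a \<in> pos_cone H" for a
    using that I_trunc H.trunc_closed by auto
  have tv: "truncated_vector_lattice Q"
  proof (intro truncated_vector_lattice.intro truncated_vector_lattice_axioms.intro vl)
    fix A assume "A \<in> pos_cone Q"
    then obtain a where a: "a \<in> I" "a \<in> pos_cone H" "A = F a" by (auto simp: pos)
    show "trunc_op Q A \<in> pos_cone Q" unfolding pos using a trunc_pos[of a] by auto
    show "vle Q (trunc_op Q A) A" using a trunc_pos[of a] H.trunc_le[of a] by simp
    show "A = \<zero>\<^bsub>Q\<^esub>" if "trunc_op Q A = \<zero>\<^bsub>Q\<^esub>"
      using that a trunc_pos[of a] H.trunc_eq_zero[of a] by (simp add: Feq)
    show "A = \<zero>\<^bsub>Q\<^esub>" if *: "\<And>n::nat. 0 < n \<Longrightarrow> real n \<odot>\<^bsub>Q\<^esub> A = trunc_op Q (real n \<odot>\<^bsub>Q\<^esub> A)"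
    proof -
      have "real n \<odot>\<^bsub>H\<^esub> a = trunc_op H (real n \<odot>\<^bsub>H\<^esub> a)" if "0 < n" for n :: nat
      proof -
        have "vle H (real n \<odot>\<^bsub>H\<^esub> \<zero>\<^bsub>H\<^esub>) (real n \<odot>\<^bsub>H\<^esub> a)"
          by (rule H.vle_smult) (use a in \<open>auto simp: pos_cone_def\<close>)
        then have p: "real n \<odot>\<^bsub>H\<^esub> a \<in> pos_cone H"
          using a H.smult_r_null[of "real n"] by (simp add: pos_cone_def)
        show ?thesis
          using *[OF that] a trunc_pos[OF _ p] by (simp add: Feq)
      qed
      then show ?thesis using a H.trunc_multiples[of a] by simp
    qed
    fix B assume "B \<in> pos_cone Q"
    then obtain b where b: "b \<in> I" "b \<in> pos_cone H" "B = F b" by (auto simp: pos)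
    show "vle Q (vmeet Q A (trunc_op Q B)) (trunc_op Q A)"
      using a b trunc_pos[of a] trunc_pos[of b] H.meet_trunc_le[of a b] by (simp add: mt)
  qed
  define \<phi> where "\<phi> x = F (\<theta> x)" for x
  have I_th [simp]: "\<theta> x \<in> I" if "x \<in> carrier G" for x using that by (simp add: I_def)
  have "\<phi> \<in> truncation_hom G Q"
    unfolding truncation_hom_def vector_lattice_hom_def
  proof (intro CollectI conjI ballI allI)
    fix g assume g: "g \<in> pos_cone G"
    then show "\<phi> (trunc_op G g) = trunc_op Q (\<phi> g)"
      by (simp add: \<phi>_def th_trunc pos_cone_def)
  qed (auto simp: \<phi>_def th_add th_smult th_join th_meet jn mt)
  moreover have "a_kernel G H \<theta> = a_kernel G Q \<phi>"
    by (auto simp: a_kernel_def' \<phi>_def Feq)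
  ultimately show ?thesis unfolding truncation_kernel_def using tv by blast
qed

end

theory Submission
  imports Defs
begin

text \<open>
  For \<open>K\<close> satisfying (2) and (3), \<open>G/K\<close> carries the truncation \<open>g + K \<mapsto> trunc g + K\<close>
  (\<open>g\<close> positive). It is well defined because \<open>g \<le> h + k\<close> with \<open>k \<ge> 0\<close> implies
  \<open>trunc g \<le> trunc h + k\<close>: the element \<open>trunc g - k\<close> lies below both \<open>h\<close> and \<open>trunc g\<close>, hence
  below \<open>trunc h\<close>. Properties (2) and (3) are the last two truncation axioms for \<open>G/K\<close>, read on
  representatives, and (1) is the archimedean property of \<open>G/K\<close>, since \<open>n g + K \<le> h + K\<close> means
  \<open>(n g - h)\<^sup>+ \<in> K\<close>.
\<close>

section \<open>Vector lattices\<close>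

context vector_lattice
begin

text \<open>As introduction rules these make \<open>auto\<close> and \<open>blast\<close> loop.\<close>

declare L.le_antisym [rule del]

lemma smult_in_carrier [simp]: "x \<in> carrier V \<Longrightarrow> r \<odot> x \<in> carrier V"
  using smult_closed[of r x] by simp

lemma join_in_carrier [simp]: "\<lbrakk>x \<in> carrier V; y \<in> carrier V\<rbrakk> \<Longrightarrow> vjoin V x y \<in> carrier V"
  using L.join_closed[of x y] by simp

lemma meet_in_carrier [simp]: "\<lbrakk>x \<in> carrier V; y \<in> carrier V\<rbrakk> \<Longrightarrow> vmeet V x y \<in> carrier V"
  using L.meet_closed[of x y] by simp

lemma vle_refl: "x \<in> carrier V \<Longrightarrow> x \<preceq> x"
  using L.le_refl[of x] by simp

lemma vle_antisym: "\<lbrakk>x \<preceq> y; y \<preceq> x; x \<in> carrier V; y \<in> carrier V\<rbrakk> \<Longrightarrow> x = y"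
  using L.le_antisym[of x y] by simp

lemma vle_trans:
  "\<lbrakk>x \<preceq> y; y \<preceq> z; x \<in> carrier V; y \<in> carrier V; z \<in> carrier V\<rbrakk> \<Longrightarrow> x \<preceq> z"
  using L.le_trans[of x y z] by simp

lemma vle_join1: "\<lbrakk>x \<in> carrier V; y \<in> carrier V\<rbrakk> \<Longrightarrow> x \<preceq> vjoin V x y"
  using L.join_left[of x y] by simp

lemma vle_join2: "\<lbrakk>x \<in> carrier V; y \<in> carrier V\<rbrakk> \<Longrightarrow> y \<preceq> vjoin V x y"
  using L.join_right[of x y] by simp

lemma join_vle:
  "\<lbrakk>x \<preceq> z; y \<preceq> z; x \<in> carrier V; y \<in> carrier V; z \<in> carrier V\<rbrakk> \<Longrightarrow> vjoin V x y \<preceq> z"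
  using L.join_le[of x z y] by simp

lemma meet_vle1: "\<lbrakk>x \<in> carrier V; y \<in> carrier V\<rbrakk> \<Longrightarrow> vmeet V x y \<preceq> x"
  using L.meet_left[of x y] by simp

lemma meet_vle2: "\<lbrakk>x \<in> carrier V; y \<in> carrier V\<rbrakk> \<Longrightarrow> vmeet V x y \<preceq> y"
  using L.meet_right[of x y] by simp

lemma vle_meet:
  "\<lbrakk>z \<preceq> x; z \<preceq> y; x \<in> carrier V; y \<in> carrier V; z \<in> carrier V\<rbrakk> \<Longrightarrow> z \<preceq> vmeet V x y"
  using L.meet_le[of z x y] by simp

lemma vle_add_mono:
  assumes "x \<preceq> y" "z \<preceq> w" "x \<in> carrier V" "y \<in> carrier V" "z \<in> carrier V" "w \<in> carrier V"
  shows "x \<oplus> z \<preceq> y \<oplus> w"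
proof (rule vle_trans)
  show "x \<oplus> z \<preceq> y \<oplus> z" using assms by (simp add: vle_add)
  show "y \<oplus> z \<preceq> y \<oplus> w" using assms vle_add[of z w y] by (simp add: M.a_comm)
qed (use assms in simp_all)

lemma minus_vle_iff:
  assumes "x \<in> carrier V" "y \<in> carrier V" "z \<in> carrier V"
  shows "x \<ominus> y \<preceq> z \<longleftrightarrow> x \<preceq> y \<oplus> z"
proof
  assume "x \<ominus> y \<preceq> z"
  then have "(x \<ominus> y) \<oplus> y \<preceq> z \<oplus> y" using assms by (simp add: vle_add)
  moreover have "(x \<ominus> y) \<oplus> y = x" using assms by (simp add: M.minus_eq M.a_assoc M.l_neg)
  ultimately show "x \<preceq> y \<oplus> z" using assms by (simp add: M.a_comm)
next
  assume "x \<preceq> y \<oplus> z"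
  then have "x \<oplus> (\<ominus> y) \<preceq> (y \<oplus> z) \<oplus> (\<ominus> y)" using assms by (simp add: vle_add)
  moreover have "(y \<oplus> z) \<oplus> (\<ominus> y) = z"
    using assms by (simp add: M.a_comm[of y z] M.a_assoc M.r_neg)
  ultimately show "x \<ominus> y \<preceq> z" by (simp add: M.minus_eq)
qed

lemma vle_add_pos:
  assumes "x \<preceq> y" "k \<in> pos_cone V" "x \<in> carrier V" "y \<in> carrier V"
  shows "x \<preceq> y \<oplus> k"
  using vle_add_mono[of x y \<zero> k] assms by (simp add: pos_cone_def)

lemma pos_part_in_pos_cone: "x \<in> carrier V \<Longrightarrow> pos_part V x \<in> pos_cone V"
  by (simp add: pos_part_def pos_cone_def vle_join2)

lemma pos_cone_carrier: "x \<in> pos_cone V \<Longrightarrow> x \<in> carrier V"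
  by (simp add: pos_cone_def)

lemma smult_pos_cone: "\<lbrakk>0 \<le> r; x \<in> pos_cone V\<rbrakk> \<Longrightarrow> r \<odot> x \<in> pos_cone V"
  using vle_smult[of r \<zero> x] smult_r_null[of r] by (simp add: pos_cone_def)

lemma minus_eq_zero_iff:
  "\<lbrakk>x \<in> carrier V; y \<in> carrier V\<rbrakk> \<Longrightarrow> x \<ominus> y = \<zero> \<longleftrightarrow> x = y"
  by (metis M.add.inv_closed M.minus_equality M.minus_minus M.minus_eq M.r_neg)

end

lemma (in truncated_vector_lattice) trunc_vle_add:
  assumes g: "g \<in> pos_cone G" and h: "h \<in> pos_cone G" and k: "k \<in> pos_cone G"
    and le: "g \<preceq> h \<oplus> k"
  shows "trunc_op G g \<preceq> trunc_op G h \<oplus> k"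
proof -
  note [simp] = pos_cone_carrier[OF g] pos_cone_carrier[OF h] pos_cone_carrier[OF k]
    pos_cone_carrier[OF trunc_closed[OF g]] pos_cone_carrier[OF trunc_closed[OF h]]
  let ?u = "trunc_op G g \<ominus> k"
  have "trunc_op G g \<preceq> k \<oplus> h"
    using vle_trans[OF trunc_le[OF g] le] by (simp add: M.a_comm)
  then have "?u \<preceq> h" by (simp add: minus_vle_iff)
  moreover have "trunc_op G g \<preceq> k \<oplus> trunc_op G g"
    using vle_add_pos[OF vle_refl k, of "trunc_op G g"] by (simp add: M.a_comm)
  then have "?u \<preceq> trunc_op G g" by (simp add: minus_vle_iff)
  ultimately have "?u \<preceq> vmeet G h (trunc_op G g)" by (simp add: vle_meet)
  \<comment> \<open>The first truncation axiom enters with \<open>g\<close> and \<open>h\<close>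
    exchanged, bounding \<open>vmeet G h (trunc_op G g)\<close>. It is applied to \<open>h\<close>
    and \<open>g\<close> only, so \<open>?u\<close> may fail to be positive.\<close>
  then have "?u \<preceq> trunc_op G h" using vle_trans[OF _ meet_trunc_le[OF h g]] by simp
  then show ?thesis by (simp add: minus_vle_iff M.a_comm)
qed

section \<open>Quotients by ideals\<close>

text \<open>These are the order ideals, that is, the solid subspaces, of a Riesz space, described by
  convexity instead of absolute values.\<close>

locale vl_ideal = vector_lattice +
  fixes K
  assumes submodule: "submodule K real_ring V"
    and join_closed: "\<lbrakk>x \<in> K; y \<in> K\<rbrakk> \<Longrightarrow> vjoin V x y \<in> K"
    and convex: "\<lbrakk>x \<in> K; y \<in> K; z \<in> carrier V; x \<preceq> z; z \<preceq> y\<rbrakk> \<Longrightarrow> z \<in> K"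

sublocale vl_ideal \<subseteq> abelian_subgroup K V
proof (rule abelian_subgroupI2)
  show "comm_group (add_monoid V)" by (rule M.a_comm_group)
  show "subgroup K (add_monoid V)" using submodule by (rule submodule.axioms(1))
qed

context vl_ideal
begin

lemma smult_ideal: "x \<in> K \<Longrightarrow> r \<odot> x \<in> K"
  using submodule.smult_closed[OF submodule, of r x] by simp

lemma coset_eq_ideal_iff: "x \<in> carrier V \<Longrightarrow> K +> x = K \<longleftrightarrow> x \<in> K"
  using a_rcos_const a_rcos_self by blast

lemma pos_part_ideal: "x \<in> K \<Longrightarrow> pos_part V x \<in> K"
  by (simp add: pos_part_def join_closed)

text \<open>The parameter \<open>m\<close> lets the results apply to \<open>vl_quotient V K\<close> as well as to its extension
  by a truncation.\<close>

abbreviation quotient_ext :: "'c \<Rightarrow> ('a set, 'c) vlattice_scheme" where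
  "quotient_ext m \<equiv> vlattice.extend (vl_quotient V K) m"

lemma quotient_ext_simps [simp]:
  "carrier (quotient_ext m) = a_rcosets K"
  "zero (quotient_ext m) = K"
  "add (quotient_ext m) = set_add V"
  "smult (quotient_ext m) r A = (\<Union>x\<in>A. K +> (r \<odot> x))"
  "vle (quotient_ext m) A B = (\<exists>x\<in>A. \<exists>y\<in>B. x \<preceq> y)"
  by (simp_all add: vlattice.defs vl_quotient_def)

lemma cosets_eq: "a_rcosets K = (\<lambda>x. K +> x) ` carrier V"
  by (auto simp: A_RCOSETS_def')

section \<open>Order of cosets through representatives\<close>

lemma coset_eqI:
  assumes "x \<in> carrier V" "y \<in> carrier V" "x \<ominus> y \<in> K"
  shows "K +> x = K +> y"
  using assms a_rcos_module[of y x] a_repr_independence'[of x y] by (simp add: M.minus_eq)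

text \<open>\<open>vl_quotient\<close> compares cosets by some pair of their members. Moving both
  deviations from \<open>x\<close> and \<open>y\<close> to the larger side leaves one error term
  \<open>k\<close> in \<open>K\<close>; the order is handled in this form from here on.\<close>

lemma coset_le_iff:
  assumes x: "x \<in> carrier V" and y: "y \<in> carrier V"
  shows "(\<exists>x'\<in>K +> x. \<exists>y'\<in>K +> y. x' \<preceq> y') \<longleftrightarrow> (\<exists>k\<in>K. x \<preceq> y \<oplus> k)"
proof
  assume "\<exists>x'\<in>K +> x. \<exists>y'\<in>K +> y. x' \<preceq> y'"
  then obtain k l where kl: "k \<in> K" "l \<in> K" "k \<oplus> x \<preceq> l \<oplus> y" by (auto simp: a_r_coset_def')
  then have "(k \<oplus> x) \<oplus> (\<ominus> k) \<preceq> (l \<oplus> y) \<oplus> (\<ominus> k)" using x y by (intro vle_add) auto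
  moreover have "(k \<oplus> x) \<oplus> (\<ominus> k) = x" using kl x by (simp add: M.a_comm[of k x] M.a_assoc M.r_neg)
  moreover have "(l \<oplus> y) \<oplus> (\<ominus> k) = y \<oplus> (l \<oplus> (\<ominus> k))" using kl y by (simp add: M.a_comm[of l y] M.a_assoc)
  ultimately have "x \<preceq> y \<oplus> (l \<oplus> (\<ominus> k))" by simp
  then show "\<exists>k\<in>K. x \<preceq> y \<oplus> k" using kl by (intro bexI[of _ "l \<oplus> (\<ominus> k)"]) auto
next
  assume "\<exists>k\<in>K. x \<preceq> y \<oplus> k"
  then obtain k where k: "k \<in> K" "x \<preceq> y \<oplus> k" by blast
  have "k \<oplus> y \<in> K +> y" using k by (auto simp: a_r_coset_def')
  moreover have "k \<oplus> y = y \<oplus> k" using k y by (simp add: M.a_comm)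
  ultimately show "\<exists>x'\<in>K +> x. \<exists>y'\<in>K +> y. x' \<preceq> y'" using k a_rcos_self[OF x] by auto
qed

text \<open>\<open>pos_part V (x \<ominus> y)\<close> is the least positive error that can serve as
  \<open>k\<close>. Convexity puts it into \<open>K\<close> as soon as some error in
  \<open>K\<close> exists, because it lies between zero and \<open>pos_part V k\<close>.\<close>

lemma coset_le_iff_pos_part:
  assumes x: "x \<in> carrier V" and y: "y \<in> carrier V"
  shows "(\<exists>k\<in>K. x \<preceq> y \<oplus> k) \<longleftrightarrow> pos_part V (x \<ominus> y) \<in> K"
proof
  assume "\<exists>k\<in>K. x \<preceq> y \<oplus> k"
  then obtain k where k: "k \<in> K" "x \<preceq> y \<oplus> k" by blast
  have kc: "k \<in> carrier V" "pos_part V k \<in> carrier V"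
    using k pos_part_in_pos_cone pos_cone_carrier by auto
  \<comment> \<open>\<open>k\<close> is replaced by its positive part, still in \<open>K\<close>, in
    order to bound zero as well as \<open>x \<ominus> y\<close>; \<open>k\<close> itself need not be
    positive.\<close>
  have "x \<ominus> y \<preceq> pos_part V k"
  proof (rule vle_trans)
    show "x \<ominus> y \<preceq> k" using k kc x y by (simp add: minus_vle_iff)
    show "k \<preceq> pos_part V k" using kc by (simp add: pos_part_def vle_join1)
  qed (use kc x y in simp_all)
  then have "pos_part V (x \<ominus> y) \<preceq> pos_part V k"
    unfolding pos_part_def[of V "x \<ominus> y"] using kc x y pos_part_in_pos_cone[of k]
    by (intro join_vle) (simp_all add: pos_cone_def)
  moreover have "\<zero> \<preceq> pos_part V (x \<ominus> y)" "pos_part V (x \<ominus> y) \<in> carrier V"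
    using pos_part_in_pos_cone[of "x \<ominus> y"] x y by (simp_all add: pos_cone_def)
  ultimately show "pos_part V (x \<ominus> y) \<in> K"
    using convex[of \<zero> "pos_part V k"] pos_part_ideal[OF k(1)] by simp
next
  assume *: "pos_part V (x \<ominus> y) \<in> K"
  have "x \<ominus> y \<preceq> pos_part V (x \<ominus> y)" using x y by (simp add: pos_part_def vle_join1)
  then have "x \<preceq> y \<oplus> pos_part V (x \<ominus> y)" using x y * by (simp add: minus_vle_iff)
  then show "\<exists>k\<in>K. x \<preceq> y \<oplus> k" using * by blast
qed

text \<open>The two inequalities trap \<open>x \<ominus> y\<close> between
  \<open>\<ominus> l\<close> and \<open>k\<close>, both in \<open>K\<close>, so convexity puts the
  difference into \<open>K\<close>.\<close>

lemma coset_le_antisym: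
  assumes x: "x \<in> carrier V" and y: "y \<in> carrier V"
    and "\<exists>k\<in>K. x \<preceq> y \<oplus> k" "\<exists>k\<in>K. y \<preceq> x \<oplus> k"
  shows "K +> x = K +> y"
proof -
  obtain k l where kl: "k \<in> K" "l \<in> K" "x \<preceq> y \<oplus> k" "y \<preceq> x \<oplus> l" using assms by blast
  have "x \<ominus> y \<preceq> k" using kl x y by (simp add: minus_vle_iff)
  moreover have "\<ominus> l \<preceq> x \<ominus> y"
  proof -
    have "y \<oplus> ((\<ominus> l) \<oplus> (\<ominus> y)) \<preceq> (x \<oplus> l) \<oplus> ((\<ominus> l) \<oplus> (\<ominus> y))"
      using kl x y by (intro vle_add) auto
    moreover have "y \<oplus> ((\<ominus> l) \<oplus> (\<ominus> y)) = \<ominus> l"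
      using kl y by (simp add: M.a_comm[of "\<ominus> l"] M.r_neg2)
    moreover have "(x \<oplus> l) \<oplus> ((\<ominus> l) \<oplus> (\<ominus> y)) = x \<ominus> y"
      using kl x y by (simp add: M.a_assoc M.r_neg2 M.minus_eq)
    ultimately show ?thesis by simp
  qed
  ultimately have "x \<ominus> y \<in> K" using convex[of "\<ominus> l" k] kl x y by simp
  then show ?thesis using x y by (simp add: coset_eqI)
qed

lemma coset_le_trans:
  assumes "\<exists>k\<in>K. x \<preceq> y \<oplus> k" "\<exists>k\<in>K. y \<preceq> z \<oplus> k"
    and c: "x \<in> carrier V" "y \<in> carrier V" "z \<in> carrier V"
  shows "\<exists>k\<in>K. x \<preceq> z \<oplus> k"
proof -
  obtain k l where kl: "k \<in> K" "l \<in> K" "x \<preceq> y \<oplus> k" "y \<preceq> z \<oplus> l" using assms by blast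
  have "y \<oplus> k \<preceq> (z \<oplus> l) \<oplus> k" using kl c by (simp add: vle_add)
  then have "x \<preceq> (z \<oplus> l) \<oplus> k" using vle_trans[OF kl(3)] kl c by simp
  then show ?thesis using kl c by (intro bexI[of _ "l \<oplus> k"]) (simp_all add: M.a_assoc)
qed

lemma coset_le_of_le: "\<lbrakk>x \<preceq> y; x \<in> carrier V; y \<in> carrier V\<rbrakk> \<Longrightarrow> \<exists>k\<in>K. x \<preceq> y \<oplus> k"
  by (intro bexI[of _ \<zero>]) simp_all

text \<open>Adding a positive term to the larger side preserves an inequality, so two bounds with
  positive errors \<open>k\<close> and \<open>l\<close> share the error \<open>k \<oplus> l\<close>.
  This is how bounds are merged for joins and meets; \<open>trunc_vle_add\<close> asks for a
  positive error too.\<close>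

lemma coset_le_pos:
  assumes "\<exists>k\<in>K. x \<preceq> y \<oplus> k" and c: "x \<in> carrier V" "y \<in> carrier V"
  obtains k where "k \<in> K" "k \<in> pos_cone V" "x \<preceq> y \<oplus> k"
proof
  have "pos_part V (x \<ominus> y) \<in> K" using assms by (simp add: coset_le_iff_pos_part)
  moreover have "x \<ominus> y \<preceq> pos_part V (x \<ominus> y)" using c by (simp add: pos_part_def vle_join1)
  ultimately show "pos_part V (x \<ominus> y) \<in> K" "x \<preceq> y \<oplus> pos_part V (x \<ominus> y)"
    using c by (simp_all add: minus_vle_iff)
  show "pos_part V (x \<ominus> y) \<in> pos_cone V" using c by (simp add: pos_part_in_pos_cone)
qed

lemma coset_join_le:
  assumes "\<exists>k\<in>K. x \<preceq> z \<oplus> k" "\<exists>k\<in>K. y \<preceq> z \<oplus> k"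
    and c: "x \<in> carrier V" "y \<in> carrier V" "z \<in> carrier V"
  shows "\<exists>k\<in>K. vjoin V x y \<preceq> z \<oplus> k"
proof -
  obtain k l where kl: "k \<in> K" "k \<in> pos_cone V" "x \<preceq> z \<oplus> k" "l \<in> K" "l \<in> pos_cone V" "y \<preceq> z \<oplus> l"
    using coset_le_pos[OF assms(1)] coset_le_pos[OF assms(2)] c by metis
  have "x \<preceq> (z \<oplus> k) \<oplus> l" "y \<preceq> (z \<oplus> l) \<oplus> k" using kl c by (simp_all add: vle_add_pos)
  then have "x \<preceq> z \<oplus> (k \<oplus> l)" "y \<preceq> z \<oplus> (k \<oplus> l)"
    using kl c by (simp_all add: M.a_assoc M.a_comm[of l k])
  then have "vjoin V x y \<preceq> z \<oplus> (k \<oplus> l)" using kl c by (simp add: join_vle)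
  then show ?thesis using kl by (intro bexI[of _ "k \<oplus> l"]) simp_all
qed

lemma coset_le_meet:
  assumes "\<exists>k\<in>K. z \<preceq> x \<oplus> k" "\<exists>k\<in>K. z \<preceq> y \<oplus> k"
    and c: "x \<in> carrier V" "y \<in> carrier V" "z \<in> carrier V"
  shows "\<exists>k\<in>K. z \<preceq> vmeet V x y \<oplus> k"
proof -
  obtain k l where kl: "k \<in> K" "k \<in> pos_cone V" "z \<preceq> x \<oplus> k" "l \<in> K" "l \<in> pos_cone V" "z \<preceq> y \<oplus> l"
    using coset_le_pos[OF assms(1)] coset_le_pos[OF assms(2)] c by metis
  have "z \<preceq> (x \<oplus> k) \<oplus> l" "z \<preceq> (y \<oplus> l) \<oplus> k" using kl c by (simp_all add: vle_add_pos)
  then have "z \<preceq> (k \<oplus> l) \<oplus> x" "z \<preceq> (k \<oplus> l) \<oplus> y"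
    using kl c by (simp_all add: M.a_ac)
  \<comment> \<open>The error is moved to the side of \<open>z\<close>, where
    \<open>z \<ominus> (k \<oplus> l)\<close> is a common lower bound of \<open>x\<close> and
    \<open>y\<close>; this avoids distributing a sum over a meet.\<close>
  then have "z \<ominus> (k \<oplus> l) \<preceq> vmeet V x y" using kl c by (simp add: minus_vle_iff vle_meet)
  then have "z \<preceq> vmeet V x y \<oplus> (k \<oplus> l)" using kl c by (simp add: minus_vle_iff M.a_comm)
  then show ?thesis using kl by (intro bexI[of _ "k \<oplus> l"]) simp_all
qed

section \<open>Lattice operations and scalar multiples of cosets\<close>

lemma coset_join_cong:
  assumes c: "x \<in> carrier V" "y \<in> carrier V" "x' \<in> carrier V" "y' \<in> carrier V"
    and eq: "K +> x = K +> x'" "K +> y = K +> y'"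
  shows "K +> vjoin V x y = K +> vjoin V x' y'"
proof -
  \<comment> \<open>One inequality is enough: exchanging the two pairs gives the other, and
    \<open>coset_le_antisym\<close> concludes.\<close>
  have le: "\<exists>k\<in>K. vjoin V a b \<preceq> vjoin V a' b' \<oplus> k"
    if c: "a \<in> carrier V" "b \<in> carrier V" "a' \<in> carrier V" "b' \<in> carrier V"
      and eq: "K +> a = K +> a'" "K +> b = K +> b'" for a b a' b'
  proof (rule coset_join_le)
    \<comment> \<open>\<open>coset_le_iff\<close> is used in both directions: the relation between
      cosets does not see the representative, so the bound of \<open>a'\<close> by the join passes
      to \<open>a\<close>, and likewise from \<open>b'\<close> to \<open>b\<close>.\<close>
    have "\<exists>k\<in>K. a \<preceq> vjoin V a' b' \<oplus> k" "\<exists>k\<in>K. b \<preceq> vjoin V a' b' \<oplus> k"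
      using c coset_le_iff[of a "vjoin V a' b'"] coset_le_iff[of a' "vjoin V a' b'"]
        coset_le_iff[of b "vjoin V a' b'"] coset_le_iff[of b' "vjoin V a' b'"]
        coset_le_of_le[OF vle_join1[of a' b']] coset_le_of_le[OF vle_join2[of a' b']] eq
      by simp_all
    then show "\<exists>k\<in>K. a \<preceq> vjoin V a' b' \<oplus> k" "\<exists>k\<in>K. b \<preceq> vjoin V a' b' \<oplus> k" .
  qed (use c in simp_all)
  show ?thesis using le[OF c eq] le[of x' y' x y] c eq by (simp add: coset_le_antisym)
qed

lemma coset_meet_cong:
  assumes c: "x \<in> carrier V" "y \<in> carrier V" "x' \<in> carrier V" "y' \<in> carrier V"
    and eq: "K +> x = K +> x'" "K +> y = K +> y'"
  shows "K +> vmeet V x y = K +> vmeet V x' y'"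
proof -
  have le: "\<exists>k\<in>K. vmeet V a b \<preceq> vmeet V a' b' \<oplus> k"
    if c: "a \<in> carrier V" "b \<in> carrier V" "a' \<in> carrier V" "b' \<in> carrier V"
      and eq: "K +> a = K +> a'" "K +> b = K +> b'" for a b a' b'
  proof (rule coset_le_meet)
    \<comment> \<open>Here the representative changes on the larger side: the bound of the meet by
      \<open>a\<close> becomes one by \<open>a'\<close>, which has the same coset.\<close>
    have "\<exists>k\<in>K. vmeet V a b \<preceq> a' \<oplus> k" "\<exists>k\<in>K. vmeet V a b \<preceq> b' \<oplus> k"
      using c coset_le_iff[of "vmeet V a b" a] coset_le_iff[of "vmeet V a b" a']
        coset_le_iff[of "vmeet V a b" b] coset_le_iff[of "vmeet V a b" b']
        coset_le_of_le[OF meet_vle1[of a b]] coset_le_of_le[OF meet_vle2[of a b]] eq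
      by simp_all
    then show "\<exists>k\<in>K. vmeet V a b \<preceq> a' \<oplus> k" "\<exists>k\<in>K. vmeet V a b \<preceq> b' \<oplus> k" .
  qed (use c in simp_all)
  show ?thesis using le[OF c eq] le[of x' y' x y] c eq by (simp add: coset_le_antisym)
qed

text \<open>Two members of a coset differ by an element of the subspace \<open>K\<close>, and
  scaling keeps that difference in \<open>K\<close>. Hence all cosets in the union that defines
  scalar multiplication coincide.\<close>

lemma smult_coset:
  assumes x: "x \<in> carrier V"
  shows "(\<Union>y\<in>K +> x. K +> (r \<odot> y)) = K +> (r \<odot> x)"
proof -
  have "K +> (r \<odot> y) = K +> (r \<odot> x)" if y: "y \<in> K +> x" for y
  proof -
    obtain k where k: "k \<in> K" "y = k \<oplus> x" using y by (auto simp: a_r_coset_def')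
    have "r \<odot> y = r \<odot> k \<oplus> r \<odot> x" using k x smult_r_distr[of r k x] by simp
    then have "r \<odot> y \<in> K +> (r \<odot> x)" using smult_ideal[OF k(1)] by (auto simp: a_r_coset_def')
    then show ?thesis using a_repr_independence' x by simp
  qed
  then show ?thesis using a_rcos_self[OF x] by blast
qed

section \<open>The quotient vector lattice\<close>

lemma module_quotient: "module real_ring (quotient_ext m)"
proof (rule moduleI)
  show "cring real_ring" by (rule real_ring_cring)
  show "abelian_group (quotient_ext m)"
  proof (rule abelian_groupI)
    fix A assume "A \<in> carrier (quotient_ext m)"
    then obtain x where x: "x \<in> carrier V" "A = K +> x" by (auto simp: cosets_eq)
    then show "\<exists>B\<in>carrier (quotient_ext m). B \<oplus>\<^bsub>quotient_ext m\<^esub> A = \<zero>\<^bsub>quotient_ext m\<^esub>"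
      by (intro bexI[of _ "K +> (\<ominus> x)"])
        (auto simp: cosets_eq a_rcos_sum M.l_neg coset_eq_ideal_iff)
    show "\<zero>\<^bsub>quotient_ext m\<^esub> \<oplus>\<^bsub>quotient_ext m\<^esub> A = A"
      using x a_rcos_sum[of \<zero> x] a_rcos_const[of \<zero>] by simp
    fix B assume "B \<in> carrier (quotient_ext m)"
    then obtain y where y: "y \<in> carrier V" "B = K +> y" by (auto simp: cosets_eq)
    show "A \<oplus>\<^bsub>quotient_ext m\<^esub> B = B \<oplus>\<^bsub>quotient_ext m\<^esub> A"
      using x y by (simp add: a_rcos_sum M.a_comm)
  qed (auto simp: cosets_eq a_rcos_sum M.a_assoc a_subgroup_in_rcosets[unfolded cosets_eq])
  fix r s :: real and A B
  assume "A \<in> carrier (quotient_ext m)" "B \<in> carrier (quotient_ext m)"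
  then obtain x y where xy: "x \<in> carrier V" "y \<in> carrier V" and AB: "A = K +> x" "B = K +> y"
    by (auto simp: cosets_eq)
  note simps = AB xy cosets_eq smult_coset a_rcos_sum
  show "r \<odot>\<^bsub>quotient_ext m\<^esub> A \<in> carrier (quotient_ext m)"
    using xy by (simp add: simps)
  show "(r \<oplus>\<^bsub>real_ring\<^esub> s) \<odot>\<^bsub>quotient_ext m\<^esub> A =
      r \<odot>\<^bsub>quotient_ext m\<^esub> A \<oplus>\<^bsub>quotient_ext m\<^esub> s \<odot>\<^bsub>quotient_ext m\<^esub> A"
    using smult_l_distr[of r s x] by (simp add: simps)
  show "r \<odot>\<^bsub>quotient_ext m\<^esub> (A \<oplus>\<^bsub>quotient_ext m\<^esub> B) =
      r \<odot>\<^bsub>quotient_ext m\<^esub> A \<oplus>\<^bsub>quotient_ext m\<^esub> r \<odot>\<^bsub>quotient_ext m\<^esub> B"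
    using smult_r_distr[of r x y] by (simp add: simps)
  show "(r \<otimes>\<^bsub>real_ring\<^esub> s) \<odot>\<^bsub>quotient_ext m\<^esub> A =
      r \<odot>\<^bsub>quotient_ext m\<^esub> (s \<odot>\<^bsub>quotient_ext m\<^esub> A)"
    using smult_assoc1[of r s x] by (simp add: simps)
  show "\<one>\<^bsub>real_ring\<^esub> \<odot>\<^bsub>quotient_ext m\<^esub> A = A"
    using smult_one[of x] by (simp add: simps)
qed

text \<open>Chosen representatives make it possible to write join and meet as functions of cosets,
  the form that \<open>vector_lattice_intro\<close> takes. By the congruence lemmas the result does
  not depend on the choice.\<close>

definition rep :: "'a set \<Rightarrow> 'a" where
  "rep A = (SOME x. x \<in> A)"

lemma rep_coset:
  assumes "x \<in> carrier V"
  shows "rep (K +> x) \<in> carrier V" "K +> rep (K +> x) = K +> x"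
proof -
  have "rep (K +> x) \<in> K +> x"
    unfolding rep_def using a_rcos_self[OF assms] by (rule someI)
  then show "rep (K +> x) \<in> carrier V" "K +> rep (K +> x) = K +> x"
    using a_repr_independence'[OF _ assms] a_elemrcos_carrier[OF assms] by auto
qed

lemma quotient_le_iff:
  "\<lbrakk>x \<in> carrier V; y \<in> carrier V\<rbrakk> \<Longrightarrow>
     vle (quotient_ext m) (K +> x) (K +> y) \<longleftrightarrow> (\<exists>k\<in>K. x \<preceq> y \<oplus> k)"
  by (simp add: coset_le_iff)

text \<open>The three claims come together because \<open>vector_lattice_intro\<close> yields the
  lattice structure and the values of its operations at once. That the candidates are least upper
  and greatest lower bounds rests on \<open>coset_join_le\<close> and
  \<open>coset_le_meet\<close>.\<close>

lemma
  shows vector_lattice_quotient: "vector_lattice (quotient_ext m)"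
    and vjoin_quotient: "\<lbrakk>x \<in> carrier V; y \<in> carrier V\<rbrakk> \<Longrightarrow>
      vjoin (quotient_ext m) (K +> x) (K +> y) = K +> vjoin V x y"
    and vmeet_quotient: "\<lbrakk>x \<in> carrier V; y \<in> carrier V\<rbrakk> \<Longrightarrow>
      vmeet (quotient_ext m) (K +> x) (K +> y) = K +> vmeet V x y"
proof -
  let ?Q = "quotient_ext m"
  let ?j = "\<lambda>A B. K +> vjoin V (rep A) (rep B)"
  let ?m = "\<lambda>A B. K +> vmeet V (rep A) (rep B)"
  have j: "?j (K +> x) (K +> y) = K +> vjoin V x y"
    and m: "?m (K +> x) (K +> y) = K +> vmeet V x y"
    if "x \<in> carrier V" "y \<in> carrier V" for x y
    using that by (simp_all add: coset_join_cong[of "rep (K +> x)" "rep (K +> y)" x y]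
        coset_meet_cong[of "rep (K +> x)" "rep (K +> y)" x y] rep_coset)
  \<comment> \<open>The order stays folded so that \<open>quotient_le_iff\<close> turns it into an
    error term in \<open>K\<close> and not into a search for a pair of members.\<close>
  note [simp del] = quotient_ext_simps(5)
  note [simp] = quotient_le_iff
  note le = coset_le_of_le vle_join1 vle_join2 meet_vle1 meet_vle2
  have coset: "\<exists>x\<in>carrier V. A = K +> x" if "A \<in> carrier ?Q" for A
    using that by (auto simp: cosets_eq)
  have in_Q: "K +> x \<in> carrier ?Q" if "x \<in> carrier V" for x
    using that by (simp add: cosets_eq)
  have refl: "vle ?Q A A" if "A \<in> carrier ?Q" for A
    using coset[OF that] coset_le_of_le[OF vle_refl] by auto
  have antisym: "A = B"
    if AB: "A \<in> carrier ?Q" "B \<in> carrier ?Q" "vle ?Q A B" "vle ?Q B A" for A B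
  proof -
    obtain x y where "x \<in> carrier V" "y \<in> carrier V" "A = K +> x" "B = K +> y"
      using coset[OF AB(1)] coset[OF AB(2)] by auto
    then show ?thesis using AB(3,4) coset_le_antisym[of x y] by simp
  qed
  have trans: "vle ?Q A C"
    if ABC: "A \<in> carrier ?Q" "B \<in> carrier ?Q" "C \<in> carrier ?Q" "vle ?Q A B" "vle ?Q B C" for A B C
  proof -
    obtain x y z where "x \<in> carrier V" "y \<in> carrier V" "z \<in> carrier V"
      "A = K +> x" "B = K +> y" "C = K +> z"
      using coset[OF ABC(1)] coset[OF ABC(2)] coset[OF ABC(3)] by auto
    then show ?thesis using ABC(4,5) coset_le_trans[of x y z] by simp
  qed
  have lub: "?j A B \<in> carrier ?Q \<and> vle ?Q A (?j A B) \<and> vle ?Q B (?j A B) \<and>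
      (\<forall>C\<in>carrier ?Q. vle ?Q A C \<and> vle ?Q B C \<longrightarrow> vle ?Q (?j A B) C)"
    if AB: "A \<in> carrier ?Q" "B \<in> carrier ?Q" for A B
  proof -
    obtain x y where xy: "x \<in> carrier V" "y \<in> carrier V" "A = K +> x" "B = K +> y"
      using coset[OF AB(1)] coset[OF AB(2)] by auto
    have "vle ?Q (?j A B) C" if C: "C \<in> carrier ?Q" "vle ?Q A C" "vle ?Q B C" for C
    proof -
      obtain z where "z \<in> carrier V" "C = K +> z" using coset[OF C(1)] by blast
      then show ?thesis using C(2,3) xy coset_join_le[of x z y] by (simp add: j)
    qed
    then show ?thesis using xy by (simp add: j in_Q[simplified] le)
  qed
  have glb: "?m A B \<in> carrier ?Q \<and> vle ?Q (?m A B) A \<and> vle ?Q (?m A B) B \<and>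
      (\<forall>C\<in>carrier ?Q. vle ?Q C A \<and> vle ?Q C B \<longrightarrow> vle ?Q C (?m A B))"
    if AB: "A \<in> carrier ?Q" "B \<in> carrier ?Q" for A B
  proof -
    obtain x y where xy: "x \<in> carrier V" "y \<in> carrier V" "A = K +> x" "B = K +> y"
      using coset[OF AB(1)] coset[OF AB(2)] by auto
    have "vle ?Q C (?m A B)" if C: "C \<in> carrier ?Q" "vle ?Q C A" "vle ?Q C B" for C
    proof -
      obtain z where "z \<in> carrier V" "C = K +> z" using coset[OF C(1)] by blast
      then show ?thesis using C(2,3) xy coset_le_meet[of z x y] by (simp add: m)
    qed
    then show ?thesis using xy by (simp add: m in_Q[simplified] le)
  qed
  have add: "vle ?Q (A \<oplus>\<^bsub>?Q\<^esub> C) (B \<oplus>\<^bsub>?Q\<^esub> C)"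
    if ABC: "A \<in> carrier ?Q" "B \<in> carrier ?Q" "C \<in> carrier ?Q" "vle ?Q A B" for A B C
  proof -
    obtain x y z where c: "x \<in> carrier V" "y \<in> carrier V" "z \<in> carrier V"
      and eq: "A = K +> x" "B = K +> y" "C = K +> z"
      using coset[OF ABC(1)] coset[OF ABC(2)] coset[OF ABC(3)] by auto
    obtain k where k: "k \<in> K" "x \<preceq> y \<oplus> k" using ABC(4) c eq by auto
    have "x \<oplus> z \<preceq> (y \<oplus> k) \<oplus> z" using k c by (simp add: vle_add)
    then have "x \<oplus> z \<preceq> (y \<oplus> z) \<oplus> k" using k c by (simp add: M.a_ac)
    then show ?thesis using k c eq by (auto simp: a_rcos_sum)
  qed
  have smult: "vle ?Q (r \<odot>\<^bsub>?Q\<^esub> A) (r \<odot>\<^bsub>?Q\<^esub> B)"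
    if AB: "0 \<le> r" "A \<in> carrier ?Q" "B \<in> carrier ?Q" "vle ?Q A B" for r A B
  proof -
    obtain x y where c: "x \<in> carrier V" "y \<in> carrier V" and eq: "A = K +> x" "B = K +> y"
      using coset[OF AB(2)] coset[OF AB(3)] by auto
    obtain k where k: "k \<in> K" "x \<preceq> y \<oplus> k" using AB(4) c eq by auto
    have "r \<odot> x \<preceq> r \<odot> (y \<oplus> k)" using k c AB(1) by (simp add: vle_smult)
    then have "r \<odot> x \<preceq> r \<odot> y \<oplus> r \<odot> k" using k c smult_r_distr[of r y k] by simp
    then show ?thesis using smult_ideal[OF k(1)] c eq by (auto simp: smult_coset)
  qed
  note VL = vector_lattice_intro[of ?Q ?j ?m, OF module_quotient refl antisym trans lub glb add smult]
  show "vector_lattice ?Q" by (rule VL(1))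
  show "vjoin ?Q (K +> x) (K +> y) = K +> vjoin V x y"
    and "vmeet ?Q (K +> x) (K +> y) = K +> vmeet V x y"
    if "x \<in> carrier V" "y \<in> carrier V" for x y
    using that by (simp_all add: VL(2,3) in_Q j m del: quotient_ext_simps(1-4))
qed

section \<open>Positive cosets and the archimedean property\<close>

lemma pos_cone_quotient: "pos_cone (quotient_ext m) = (\<lambda>x. K +> x) ` pos_cone V"
proof (intro equalityI subsetI)
  fix A assume "A \<in> pos_cone (quotient_ext m)"
  then obtain x where x: "x \<in> carrier V" "A = K +> x" and le: "vle (quotient_ext m) K (K +> x)"
    by (auto simp: pos_cone_def cosets_eq)
  \<comment> \<open>\<open>K\<close> is the coset of zero, so \<open>quotient_le_iff\<close> applies
    to it. The resulting \<open>x \<oplus> k\<close> is the positive representative sought.\<close>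
  have "\<exists>k\<in>K. \<zero> \<preceq> x \<oplus> k"
    using le quotient_le_iff[of \<zero> x] x a_rcos_const[of \<zero>] by simp
  then obtain k where k: "k \<in> K" "\<zero> \<preceq> x \<oplus> k" by blast
  have "K +> (x \<oplus> k) = K +> x"
    using k x a_rcos_sum[of x k] a_rcos_sum[of x \<zero>] a_rcos_const[of k] a_rcos_const[of \<zero>] by simp
  then show "A \<in> (\<lambda>x. K +> x) ` pos_cone V"
    using k x by (auto simp: pos_cone_def intro!: image_eqI[of _ _ "x \<oplus> k"])
next
  fix A assume "A \<in> (\<lambda>x. K +> x) ` pos_cone V"
  then obtain x where x: "x \<in> carrier V" "\<zero> \<preceq> x" "A = K +> x" by (auto simp: pos_cone_def)
  then have "vle (quotient_ext m) (K +> \<zero>) (K +> x)"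
    using quotient_le_iff[of \<zero> x m] by (auto intro: coset_le_of_le)
  then show "A \<in> pos_cone (quotient_ext m)"
    using x a_rcos_const[of \<zero>] by (simp add: pos_cone_def cosets_eq)
qed

text \<open>By \<open>pos_cone_quotient\<close> the quantifiers over positive cosets become
  quantifiers over positive \<open>g\<close> and \<open>h\<close>. Each inequality is then
  translated by \<open>coset_le_iff_pos_part\<close>, and the coset of \<open>g\<close> vanishes
  exactly when \<open>g\<close> lies in \<open>K\<close>.\<close>

lemma archimedean_quotient_iff:
  "archimedean (quotient_ext m) \<longleftrightarrow>
     (\<forall>g\<in>pos_cone V. (\<exists>h\<in>pos_cone V. \<forall>n::nat. 0 < n \<longrightarrow> pos_part V (real n \<odot> g \<ominus> h) \<in> K) \<longrightarrow>
       g \<in> K)"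
proof -
  have "(real n \<odot>\<^bsub>quotient_ext m\<^esub> (K +> g)) \<preceq>\<^bsub>quotient_ext m\<^esub> (K +> h) \<longleftrightarrow>
      pos_part V (real n \<odot> g \<ominus> h) \<in> K" if "g \<in> pos_cone V" "h \<in> pos_cone V" for g h n
    using that
    by (simp add: smult_coset pos_cone_carrier coset_le_iff coset_le_iff_pos_part)
  moreover have "K +> g = \<zero>\<^bsub>quotient_ext m\<^esub> \<longleftrightarrow> g \<in> K" if "g \<in> pos_cone V" for g
    using that by (simp add: coset_eq_ideal_iff pos_cone_carrier)
  ultimately show ?thesis
    unfolding archimedean_def pos_cone_quotient by (simp del: quotient_ext_simps)
qed

end

section \<open>Truncation kernels\<close>

lemma (in truncated_vector_lattice) truncation_hom_kernel_properties:
  assumes H: "truncated_vector_lattice H" and hom: "\<theta> \<in> truncation_hom G H"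
  shows "kernel_property_2 G (a_kernel G H \<theta>)" "kernel_property_3 G (a_kernel G H \<theta>)"
proof -
  interpret H: truncated_vector_lattice H by (rule H)
  have th: "\<And>x. x \<in> carrier G \<Longrightarrow> \<theta> x \<in> carrier H"
    and th_add: "\<And>x y. \<lbrakk>x \<in> carrier G; y \<in> carrier G\<rbrakk> \<Longrightarrow> \<theta> (x \<oplus> y) = \<theta> x \<oplus>\<^bsub>H\<^esub> \<theta> y"
    and th_smult: "\<And>r x. x \<in> carrier G \<Longrightarrow> \<theta> (r \<odot> x) = r \<odot>\<^bsub>H\<^esub> \<theta> x"
    and th_join: "\<And>x y. \<lbrakk>x \<in> carrier G; y \<in> carrier G\<rbrakk> \<Longrightarrow> \<theta> (vjoin G x y) = vjoin H (\<theta> x) (\<theta> y)"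
    and th_trunc: "\<And>x. x \<in> pos_cone G \<Longrightarrow> \<theta> (trunc_op G x) = trunc_op H (\<theta> x)"
    using hom by (auto simp: truncation_hom_def vector_lattice_hom_def)
  interpret hom: abelian_group_hom G H \<theta>
    by (rule abelian_group_homI)
      (use th th_add in \<open>auto intro!: M.abelian_group_axioms H.M.abelian_group_axioms
        group_hom.intro group_hom_axioms.intro M.a_group H.M.a_group simp: hom_def\<close>)
  have th_minus: "\<theta> (x \<ominus> y) = \<theta> x \<ominus>\<^bsub>H\<^esub> \<theta> y" if "x \<in> carrier G" "y \<in> carrier G" for x y
    using that by (simp add: M.minus_eq H.M.minus_eq)
  \<comment> \<open>Positivity of \<open>x\<close> is the equation
    \<open>vjoin G x \<zero> = x\<close>, which \<open>\<theta>\<close> preserves.\<close>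
  have th_pos: "\<theta> x \<in> pos_cone H" if x: "x \<in> pos_cone G" for x
  proof -
    have "vjoin G x \<zero> = x"
      using x by (intro vle_antisym join_vle vle_join1) (auto simp: pos_cone_def vle_refl)
    then have "\<theta> x = vjoin H (\<theta> x) \<zero>\<^bsub>H\<^esub>" using th_join[of x \<zero>] x by (simp add: pos_cone_def)
    then show ?thesis using H.vle_join2[of "\<theta> x" "\<zero>\<^bsub>H\<^esub>"] x by (simp add: pos_cone_def)
  qed
  show "kernel_property_2 G (a_kernel G H \<theta>)"
    unfolding kernel_property_2_def a_kernel_def'
    by (auto simp: th_trunc pos_cone_carrier intro: H.trunc_eq_zero th_pos)
  show "kernel_property_3 G (a_kernel G H \<theta>)"
    unfolding kernel_property_3_def a_kernel_def'
  proof (intro ballI impI)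
    fix g assume g: "g \<in> pos_cone G"
      and *: "\<forall>n::nat. 0 < n \<longrightarrow> ominus G g (1 / real n) \<in> {x \<in> carrier G. \<theta> x = \<zero>\<^bsub>H\<^esub>}"
    have "real n \<odot>\<^bsub>H\<^esub> \<theta> g = trunc_op H (real n \<odot>\<^bsub>H\<^esub> \<theta> g)" if n: "0 < n" for n :: nat
    proof -
      let ?x = "real n \<odot> g"
      have x: "?x \<in> pos_cone G" "?x \<in> carrier G" "trunc_op G ?x \<in> carrier G"
        using g smult_pos_cone[of "real n" g] trunc_closed[of ?x] by (auto simp: pos_cone_carrier)
      \<comment> \<open>For \<open>r = 1 / real n\<close> the inner factor \<open>1 / r\<close> of
        \<open>ominus\<close> is \<open>real n\<close>, so \<open>?y\<close> is
        \<open>ominus G g r\<close> before the outer scaling by \<open>r\<close>. Multiplying by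
        \<open>real n\<close> undoes that scaling.\<close>
      let ?y = "?x \<ominus> trunc_op G ?x"
      have y: "?y \<in> carrier G" using x by simp
      have "(1 / real n) \<odot>\<^bsub>H\<^esub> \<theta> ?y = \<zero>\<^bsub>H\<^esub>"
        using * n y th_smult[of ?y "1 / real n"] by (auto simp: ominus_def ominus_one_def)
      then have "real n \<odot>\<^bsub>H\<^esub> ((1 / real n) \<odot>\<^bsub>H\<^esub> \<theta> ?y) = \<zero>\<^bsub>H\<^esub>"
        using H.smult_r_null[of "real n"] by simp
      then have "\<theta> ?y = \<zero>\<^bsub>H\<^esub>"
        using n th[OF y] H.smult_assoc1[of "real n" "1 / real n" "\<theta> ?y"] H.smult_one[of "\<theta> ?y"]
        by simp
      then have "\<theta> ?x = \<theta> (trunc_op G ?x)"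
        using x th by (simp add: th_minus H.minus_eq_zero_iff)
      then show ?thesis using x g by (simp add: th_trunc th_smult pos_cone_carrier)
    qed
    then have "\<theta> g = \<zero>\<^bsub>H\<^esub>" using H.trunc_multiples[OF th_pos[OF g]] by blast
    then show "g \<in> {x \<in> carrier G. \<theta> x = \<zero>\<^bsub>H\<^esub>}" using g by (simp add: pos_cone_carrier)
  qed
qed

section \<open>Truncation on the quotient and sufficiency of (2) and (3)\<close>

locale trunc_ideal = truncated_vector_lattice G + vl_ideal G K
  for G :: "'a truncated" (structure) and K
begin

text \<open>Truncation is controlled by the axioms on the positive cone only, so a coset has to be
  truncated at a positive member. On cosets without one the value is arbitrary.\<close>

definition pos_rep :: "'a set \<Rightarrow> 'a" where
  "pos_rep A = (SOME g. g \<in> A \<inter> pos_cone G)"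

definition trunc_quotient :: "'a set truncated" where
  "trunc_quotient = quotient_ext (truncated.fields (\<lambda>A. K +> trunc_op G (pos_rep A)))"

text \<open>Positive members of one coset bound each other up to a positive error in
  \<open>K\<close>. \<open>trunc_vle_add\<close> carries that error through the truncation
  unchanged, and antisymmetry identifies the cosets.\<close>

lemma trunc_op_quotient:
  assumes g: "g \<in> pos_cone G"
  shows "trunc_op trunc_quotient (K +> g) = K +> trunc_op G g"
proof -
  let ?h = "pos_rep (K +> g)"
  have "g \<in> (K +> g) \<inter> pos_cone G" using g a_rcos_self by (simp add: pos_cone_carrier)
  then have "?h \<in> (K +> g) \<inter> pos_cone G" unfolding pos_rep_def by (rule someI)
  then have h: "?h \<in> pos_cone G" "K +> g = K +> ?h"
    using a_repr_independence' g by (auto simp: pos_cone_carrier)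
  have le: "\<exists>k\<in>K. trunc_op G a \<preceq> trunc_op G b \<oplus> k"
    if ab: "a \<in> pos_cone G" "b \<in> pos_cone G" "K +> a = K +> b" for a b
  proof -
    \<comment> \<open>Reflexivity at \<open>b\<close>, transferred to \<open>a\<close> through the
      common coset.\<close>
    have "\<exists>k\<in>K. a \<preceq> b \<oplus> k"
      using ab coset_le_iff[of a b] coset_le_iff[of b b] coset_le_of_le[of b b]
      by (simp add: pos_cone_carrier vle_refl)
    then obtain k where "k \<in> K" "k \<in> pos_cone G" "a \<preceq> b \<oplus> k"
      using coset_le_pos ab by (metis pos_cone_carrier)
    then show ?thesis using trunc_vle_add ab by blast
  qed
  have "K +> trunc_op G ?h = K +> trunc_op G g"
    using h g le[of g ?h] le[of ?h g] trunc_closed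
    by (intro coset_le_antisym) (auto simp: pos_cone_carrier)
  then show ?thesis by (simp add: trunc_quotient_def vlattice.defs truncated.defs)
qed

text \<open>The inequalities among the axioms descend from \<open>G\<close> with error zero, meets
  and truncations being computed on positive representatives. The two axioms that conclude
  \<open>A = \<zero>\<close> are where (2) and (3) enter.\<close>

lemma truncated_vector_lattice_quotient:
  assumes "kernel_property_2 G K" "kernel_property_3 G K"
  shows "truncated_vector_lattice trunc_quotient"
proof (intro truncated_vector_lattice.intro truncated_vector_lattice_axioms.intro)
  let ?Q = trunc_quotient
  note pos = pos_cone_quotient[of "truncated.fields (\<lambda>A. K +> trunc_op G (pos_rep A))",
      folded trunc_quotient_def]
  note Q = quotient_ext_simps[of "truncated.fields (\<lambda>A. K +> trunc_op G (pos_rep A))",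
      folded trunc_quotient_def]
  note le = quotient_le_iff[of _ _ "truncated.fields (\<lambda>A. K +> trunc_op G (pos_rep A))",
      folded trunc_quotient_def]
  note mt = vmeet_quotient[of _ _ "truncated.fields (\<lambda>A. K +> trunc_op G (pos_rep A))",
      folded trunc_quotient_def]
  note c = pos_cone_carrier trunc_closed pos_cone_carrier[OF trunc_closed]
  show "vector_lattice ?Q" unfolding trunc_quotient_def by (rule vector_lattice_quotient)
  fix A assume "A \<in> pos_cone ?Q"
  then obtain g where g: "g \<in> pos_cone G" and A: "A = K +> g" by (auto simp: pos)
  show "trunc_op ?Q A \<in> pos_cone ?Q"
    using g by (auto simp: pos A trunc_op_quotient c)
  show "vle ?Q (trunc_op ?Q A) A"
    using g by (auto simp: A trunc_op_quotient c le intro!: coset_le_of_le trunc_le)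
  show "A = \<zero>\<^bsub>?Q\<^esub>" if "trunc_op ?Q A = \<zero>\<^bsub>?Q\<^esub>"
    using that g assms(1)
    by (auto simp: A trunc_op_quotient c Q(2) coset_eq_ideal_iff kernel_property_2_def)
  show "A = \<zero>\<^bsub>?Q\<^esub>" if *: "\<And>n::nat. 0 < n \<Longrightarrow> real n \<odot>\<^bsub>?Q\<^esub> A = trunc_op ?Q (real n \<odot>\<^bsub>?Q\<^esub> A)"
  proof -
    \<comment> \<open>By \<open>*\<close> the multiple \<open>real n \<odot> g\<close> and its
      truncation share a coset, so their difference lies in \<open>K\<close>; scaled by
      \<open>1 / real n\<close> it is \<open>ominus G g (1 / real n)\<close>.\<close>
    have "ominus G g (1 / real n) \<in> K" if n: "0 < n" for n :: nat
    proof -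
      let ?x = "real n \<odot> g"
      have x: "?x \<in> pos_cone G" using g by (simp add: smult_pos_cone)
      have "K +> ?x = K +> trunc_op G ?x"
        using *[OF n] g x by (simp add: A Q(4) smult_coset c trunc_op_quotient)
      then have "?x \<in> K +> trunc_op G ?x" using a_rcos_self[of ?x] x by (simp add: c)
      then have "?x \<ominus> trunc_op G ?x \<in> K"
        using x a_rcos_module[of "trunc_op G ?x" ?x] by (simp add: c M.minus_eq)
      then show ?thesis by (simp add: ominus_def ominus_one_def smult_ideal)
    qed
    then show ?thesis
      using g assms(2) by (auto simp: A Q(2) c coset_eq_ideal_iff kernel_property_3_def)
  qed
  fix B assume "B \<in> pos_cone ?Q"
  then obtain h where h: "h \<in> pos_cone G" and B: "B = K +> h" by (auto simp: pos)
  show "vle ?Q (vmeet ?Q A (trunc_op ?Q B)) (trunc_op ?Q A)"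
    using g h
    by (auto simp: A B trunc_op_quotient c le mt intro!: coset_le_of_le meet_trunc_le)
qed

lemma coset_truncation_hom: "(\<lambda>x. K +> x) \<in> truncation_hom G trunc_quotient"
  unfolding truncation_hom_def vector_lattice_hom_def
  by (auto simp: trunc_op_quotient)
    (auto simp: trunc_quotient_def cosets_eq a_rcos_sum smult_coset vjoin_quotient vmeet_quotient)

text \<open>Sufficiency is witnessed by the projection onto \<open>trunc_quotient\<close>, whose
  elements are cosets and so have the type required of the codomain. Its kernel is \<open>K\<close>
  by \<open>coset_eq_ideal_iff\<close>.\<close>

lemma truncation_kernel_iff:
  "truncation_kernel G K \<longleftrightarrow> kernel_property_2 G K \<and> kernel_property_3 G K"
proof
  assume "truncation_kernel G K"
  then show "kernel_property_2 G K \<and> kernel_property_3 G K"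
    unfolding truncation_kernel_def using truncation_hom_kernel_properties by blast
next
  assume "kernel_property_2 G K \<and> kernel_property_3 G K"
  moreover have "K = a_kernel G trunc_quotient (\<lambda>x. K +> x)"
    using a_subset coset_eq_ideal_iff
    by (simp add: a_kernel_def' trunc_quotient_def) blast
  ultimately show "truncation_kernel G K"
    unfolding truncation_kernel_def
    using truncated_vector_lattice_quotient coset_truncation_hom by blast
qed

lemma archimedean_vl_quotient_iff: "archimedean (vl_quotient G K) \<longleftrightarrow> kernel_property_1 G K"
  \<comment> \<open>The trivial extension by \<open>()\<close> is \<open>vl_quotient G K\<close>
    itself.\<close>
  using archimedean_quotient_iff[of "()"]
  by (simp add: kernel_property_1_def vlattice.defs vl_quotient_def)

end

theorem lemma9p1p1:
  fixes G :: "'a truncated" and K :: "'a set"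
  assumes "trunc G" and "convex_subtrunc G K"
  shows "(truncation_kernel G K \<longleftrightarrow> kernel_property_2 G K \<and> kernel_property_3 G K) \<and>
         (archimedean_truncation_kernel G K \<longleftrightarrow>
            kernel_property_1 G K \<and> kernel_property_2 G K \<and> kernel_property_3 G K)"
proof -
  have K: "submodule K real_ring G" "\<forall>x\<in>K. \<forall>y\<in>K. vjoin G x y \<in> K \<and> vmeet G x y \<in> K"
    "\<forall>x\<in>K. \<forall>y\<in>K. \<forall>z\<in>carrier G. x \<preceq>\<^bsub>G\<^esub> z \<and> z \<preceq>\<^bsub>G\<^esub> y \<longrightarrow> z \<in> K"
    using assms(2) unfolding convex_subtrunc_def by satx+
  interpret truncated_vector_lattice G using assms(1) by (rule trunc.axioms(1))
  interpret trunc_ideal G K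
  proof (intro trunc_ideal.intro vl_ideal.intro vl_ideal_axioms.intro
      truncated_vector_lattice_axioms vector_lattice_axioms)
    show "submodule K real_ring G" by (rule K(1))
    show "vjoin G x y \<in> K" if "x \<in> K" "y \<in> K" for x y
      using K(2) that by simp
    show "z \<in> K" if "x \<in> K" "y \<in> K" "z \<in> carrier G" "x \<preceq>\<^bsub>G\<^esub> z" "z \<preceq>\<^bsub>G\<^esub> y" for x y z
      using bspec[OF bspec[OF bspec[OF K(3) that(1)] that(2)] that(3)] that(4,5) by simp
  qed
  show ?thesis
    unfolding archimedean_truncation_kernel_def truncation_kernel_iff archimedean_vl_quotient_iff
    by argo
qed

end
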